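(* Let $KB=\langle P,Ab,IC,K\rangle$ be a Horn knowledge base with $IC=\emptyset$, and let $\dot{-}$ be a contraction function satisfying all the rationality postulates $(\dot{-}1)$ to $(\dot{-}8)$. Define a contraction operator $-$ on $KB^{\bullet}$ by $KB^{\bullet}-\alpha=(KB\dot{-}\alpha)^{\bullet}$ for every sentence $\alpha$. Then $-$ satisfies all the AGM postulates for contraction $(-1)$ to $(-8)$.
   Context: Fix a first-order language $\mathcal{L}$; "sentence" means a sentence of $\mathcal{L}$. A Horn knowledge base is a tuple $KB=\langle P,Ab,IC,K\rangle$ where: $P$ is an acyclic normal logic program (there is a level mapping from ground atoms to $\mathbb{N}$ such that in every ground clause $H\leftarrow L_1,\dots,L_n$ of $P$ the level of $H$ exceeds that of each $L_i$, with $|\neg A|=|A|$), all abducibles at level $0$ and no non-abducible at level $0$; $Ab$ is a set of atoms (abducibles); $IC$ is a set of sentences (integrity constraints); $K$ is a set of sentences whose atoms are all in $Ab$. An abductive interpretation is a set $I\subseteq Ab$. A level-$0$ atom $A$ is true in $I$ iff $A\in I$; an atom $A$ of level $n>0$ is true in $I$ iff some clause $A\leftarrow L_1,\dots,L_k$ of the ground instantiation of $P$ has all positive $L_j$ true in $I$ and, for every negative $L_j=\neg B_j$, $B_j$ false in $I$. Truth extends to sentences classically ($\forall$/$\exists$ via ground instances). $Mod(X)$ is the set of abductive interpretations making the sentence (or all sentences of the set) $X$ true; $Cn_P(X)=\{\alpha: Mod(X)\subseteq Mod(\alpha)\}$; $Mod(KB)=Mod(K\cup IC)$; $KB^\bullet=Cn_P(K\cup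 IC)$; $\alpha$ is accepted in $KB$ iff $\alpha\in KB^\bullet$. $KB_1\equiv KB_2$ iff $P_1=P_2,Ab_1=Ab_2,IC_1=IC_2$ and $Mod(K_1)=Mod(K_2)$. Contraction postulates for $KB\dot{-}\alpha=\langle P',Ab',IC',K'\rangle$: $(\dot{-}1)$ $P'=P,Ab'=Ab,IC'=IC$; $(\dot{-}2)$ if $\alpha$ is not true in all abductive interpretations, then $\alpha$ is not accepted in $KB\dot{-}\alpha$; $(\dot{-}3)$ $Mod(KB)\subseteq Mod(KB\dot{-}\alpha)$; $(\dot{-}4)$ if $\alpha$ is not accepted in $KB$ then $Mod(KB\dot{-}\alpha)=Mod(KB)$; $(\dot{-}5)$ $Mod(KB\dot{-}\alpha)\cap Mod(\alpha)\subseteq Mod(KB)$; $(\dot{-}6)$ if $KB\equiv KB'$ and $Mod(\alpha)=Mod(\beta)$ then $Mod(KB\dot{-}\alpha)=Mod(KB'\dot{-}\beta)$; $(\dot{-}7)$ $Mod(KB\dot{-}(\alpha\land\beta))\subseteq Mod(KB\dot{-}\alpha)\cup Mod(KB\dot{-}\beta)$; $(\dot{-}8)$ if $\alpha$ is not accepted in $KB\dot{-}(\alpha\land\beta)$ then $Mod(KB\dot{-}\alpha)\subseteq Mod(KB\dot{-}(\alpha\land\beta))$. AGM setting (with respect to $Cn_P$): a belief set is a set $T$ of sentences with $T=Cn_P(T)$; $T\#\alpha=Cn_P(T\cup\{\alpha\})$; $\vdash\varphi$ means $\varphi\in Cn_P(\emptyset)$. AGM contraction postulates for $T=KB^\bullet$: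 $(-1)$ $T-\alpha$ is a belief set; $(-2)$ $T-\alpha\subseteq T$; $(-3)$ if $\alpha\notin T$ then $T-\alpha=T$; $(-4)$ if $\nvdash\alpha$ then $\alpha\notin T-\alpha$; $(-5)$ if $\vdash\alpha\leftrightarrow\beta$ then $T-\alpha=T-\beta$; $(-6)$ $T\subseteq(T-\alpha)\#\alpha$; $(-7)$ $(T-\alpha)\cap(T-\beta)\subseteq T-(\alpha\land\beta)$; $(-8)$ if $\alpha\notin T-(\alpha\land\beta)$ then $T-(\alpha\land\beta)\subseteq T-\alpha$. *)

theory Defs
  imports Main
begin

datatype 'f trm = Var nat | Fn 'f "'f trm list"

datatype ('f, 'p) atom = Atom 'p "'f trm list"

datatype ('f, 'p) form =
    Atm "('f, 'p) atom"
  | Neg "('f, 'p) form"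
  | Conj "('f, 'p) form" "('f, 'p) form"
  | Disj "('f, 'p) form" "('f, 'p) form"
  | Imp "('f, 'p) form" "('f, 'p) form"
  | Iff "('f, 'p) form" "('f, 'p) form"
  | Forall nat "('f, 'p) form"
  | Exists nat "('f, 'p) form"

text \<open>Symbols come with their arity; constants are function symbols of arity 0.
  Both sets may be empty.\<close>

record ('f, 'p) lang =
  funcs :: "('f \<times> nat) set"
  preds :: "('p \<times> nat) set"

fun vars_trm :: "'f trm \<Rightarrow> nat set" where
  "vars_trm (Var x) = {x}"
| "vars_trm (Fn f ts) = (\<Union>t\<in>set ts. vars_trm t)"

fun wf_trm :: "('f, 'p) lang \<Rightarrow> 'f trm \<Rightarrow> bool" where
  "wf_trm L (Var x) \<longleftrightarrow> True"
| "wf_trm L (Fn f ts) \<longleftrightarrow> (f, length ts) \<in> funcs L \<and> (\<forall>t\<in>set ts. wf_trm L t)"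

fun subst_trm :: "(nat \<Rightarrow> 'f trm) \<Rightarrow> 'f trm \<Rightarrow> 'f trm" where
  "subst_trm \<sigma> (Var x) = \<sigma> x"
| "subst_trm \<sigma> (Fn f ts) = Fn f (map (subst_trm \<sigma>) ts)"

fun vars_atom :: "('f, 'p) atom \<Rightarrow> nat set" where
  "vars_atom (Atom p ts) = (\<Union>t\<in>set ts. vars_trm t)"

fun wf_atom :: "('f, 'p) lang \<Rightarrow> ('f, 'p) atom \<Rightarrow> bool" where
  "wf_atom L (Atom p ts) \<longleftrightarrow> (p, length ts) \<in> preds L \<and> (\<forall>t\<in>set ts. wf_trm L t)"

fun subst_atom :: "(nat \<Rightarrow> 'f trm) \<Rightarrow> ('f, 'p) atom \<Rightarrow> ('f, 'p) atom" where
  "subst_atom \<sigma> (Atom p ts) = Atom p (map (subst_trm \<sigma>) ts)"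

definition herbrand_universe :: "('f, 'p) lang \<Rightarrow> 'f trm set" where
  "herbrand_universe L = {t. wf_trm L t \<and> vars_trm t = {}}"

definition herbrand_base :: "('f, 'p) lang \<Rightarrow> ('f, 'p) atom set" where
  "herbrand_base L = {A. wf_atom L A \<and> vars_atom A = {}}"

primrec free_vars :: "('f, 'p) form \<Rightarrow> nat set" where
  "free_vars (Atm A) = vars_atom A"
| "free_vars (Neg \<phi>) = free_vars \<phi>"
| "free_vars (Conj \<phi> \<psi>) = free_vars \<phi> \<union> free_vars \<psi>"
| "free_vars (Disj \<phi> \<psi>) = free_vars \<phi> \<union> free_vars \<psi>"
| "free_vars (Imp \<phi> \<psi>) = free_vars \<phi> \<union> free_vars \<psi>"
| "free_vars (Iff \<phi> \<psi>) = free_vars \<phi> \<union> free_vars \<psi>"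
| "free_vars (Forall x \<phi>) = free_vars \<phi> - {x}"
| "free_vars (Exists x \<phi>) = free_vars \<phi> - {x}"

primrec atoms_form :: "('f, 'p) form \<Rightarrow> ('f, 'p) atom set" where
  "atoms_form (Atm A) = {A}"
| "atoms_form (Neg \<phi>) = atoms_form \<phi>"
| "atoms_form (Conj \<phi> \<psi>) = atoms_form \<phi> \<union> atoms_form \<psi>"
| "atoms_form (Disj \<phi> \<psi>) = atoms_form \<phi> \<union> atoms_form \<psi>"
| "atoms_form (Imp \<phi> \<psi>) = atoms_form \<phi> \<union> atoms_form \<psi>"
| "atoms_form (Iff \<phi> \<psi>) = atoms_form \<phi> \<union> atoms_form \<psi>"
| "atoms_form (Forall x \<phi>) = atoms_form \<phi>"
| "atoms_form (Exists x \<phi>) = atoms_form \<phi>"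

definition sentence :: "('f, 'p) lang \<Rightarrow> ('f, 'p) form \<Rightarrow> bool" where
  "sentence L \<phi> \<longleftrightarrow> (\<forall>A\<in>atoms_form \<phi>. wf_atom L A) \<and> free_vars \<phi> = {}"

text \<open>Replaces the free occurrences of \<open>x\<close> by \<open>t\<close>. It is only used with ground \<open>t\<close>,
  so no variable can be captured.\<close>

primrec inst :: "nat \<Rightarrow> 'f trm \<Rightarrow> ('f, 'p) form \<Rightarrow> ('f, 'p) form" where
  "inst x t (Atm A) = Atm (subst_atom (Var(x := t)) A)"
| "inst x t (Neg \<phi>) = Neg (inst x t \<phi>)"
| "inst x t (Conj \<phi> \<psi>) = Conj (inst x t \<phi>) (inst x t \<psi>)"
| "inst x t (Disj \<phi> \<psi>) = Disj (inst x t \<phi>) (inst x t \<psi>)"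
| "inst x t (Imp \<phi> \<psi>) = Imp (inst x t \<phi>) (inst x t \<psi>)"
| "inst x t (Iff \<phi> \<psi>) = Iff (inst x t \<phi>) (inst x t \<psi>)"
| "inst x t (Forall y \<phi>) = Forall y (if x = y then \<phi> else inst x t \<phi>)"
| "inst x t (Exists y \<phi>) = Exists y (if x = y then \<phi> else inst x t \<phi>)"

datatype ('f, 'p) literal =
    PosLit (lit_atom: "('f, 'p) atom")
  | NegLit (lit_atom: "('f, 'p) atom")

datatype ('f, 'p) clause =
  Clause (head: "('f, 'p) atom") (body: "('f, 'p) literal list")

definition clause_atoms :: "('f, 'p) clause \<Rightarrow> ('f, 'p) atom set" where
  "clause_atoms c = insert (head c) (lit_atom ` set (body c))"

fun subst_lit :: "(nat \<Rightarrow> 'f trm) \<Rightarrow> ('f, 'p) literal \<Rightarrow> ('f, 'p) literal" where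
  "subst_lit \<sigma> (PosLit A) = PosLit (subst_atom \<sigma> A)"
| "subst_lit \<sigma> (NegLit A) = NegLit (subst_atom \<sigma> A)"

fun subst_clause :: "(nat \<Rightarrow> 'f trm) \<Rightarrow> ('f, 'p) clause \<Rightarrow> ('f, 'p) clause" where
  "subst_clause \<sigma> (Clause H B) = Clause (subst_atom \<sigma> H) (map (subst_lit \<sigma>) B)"

definition ground_instantiation ::
  "('f, 'p) lang \<Rightarrow> ('f, 'p) clause set \<Rightarrow> ('f, 'p) clause set" where
  "ground_instantiation L P =
     {subst_clause \<sigma> c | \<sigma> c. c \<in> P \<and>
        (\<forall>A\<in>clause_atoms c. \<forall>x\<in>vars_atom A. \<sigma> x \<in> herbrand_universe L)}"

definition level_mapping ::
  "('f, 'p) lang \<Rightarrow> ('f, 'p) clause set \<Rightarrow> ('f, 'p) atom set \<Rightarrow> (('f, 'p) atom \<Rightarrow> nat) \<Rightarrow> bool"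
where
  "level_mapping L P Ab lev \<longleftrightarrow>
     (\<forall>c\<in>ground_instantiation L P. \<forall>l\<in>set (body c). lev (lit_atom l) < lev (head c)) \<and>
     (\<forall>A\<in>herbrand_base L. lev A = 0 \<longleftrightarrow> A \<in> Ab)"

record ('f, 'p) kb =
  prog :: "('f, 'p) clause set"
  abd :: "('f, 'p) atom set"
  ic :: "('f, 'p) form set"
  kn :: "('f, 'p) form set"

text \<open>Abducibles are ground atoms. For a sentence with quantifiers, having only
  atoms in \<open>Ab\<close> means that all ground instances of its atoms belong to \<open>Ab\<close>.\<close>

definition abducible_form ::
  "('f, 'p) lang \<Rightarrow> ('f, 'p) atom set \<Rightarrow> ('f, 'p) form \<Rightarrow> bool" where
  "abducible_form L Ab \<phi> \<longleftrightarrow>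
     (\<forall>A\<in>atoms_form \<phi>. \<forall>\<sigma>. (\<forall>x\<in>vars_atom A. \<sigma> x \<in> herbrand_universe L) \<longrightarrow> subst_atom \<sigma> A \<in> Ab)"

definition horn_kb :: "('f, 'p) lang \<Rightarrow> ('f, 'p) kb \<Rightarrow> bool" where
  "horn_kb L KB \<longleftrightarrow>
     (\<forall>c\<in>prog KB. \<forall>A\<in>clause_atoms c. wf_atom L A) \<and>
     abd KB \<subseteq> herbrand_base L \<and>
     (\<exists>lev. level_mapping L (prog KB) (abd KB) lev) \<and>
     (\<forall>\<phi>\<in>ic KB. sentence L \<phi>) \<and>
     (\<forall>\<phi>\<in>kn KB. sentence L \<phi> \<and> abducible_form L (abd KB) \<phi>)"

text \<open>The recursion on levels is expressed by well-founded recursion along the dependency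
  relation of the ground program, so that no level mapping has to be chosen. For any level
  mapping, level 0 consists exactly of the abducibles; the lemmas \<open>true_atom_level_0\<close> and
  \<open>true_atom_level_pos\<close> below recover the level-wise clauses.\<close>

definition depends_on ::
  "('f, 'p) lang \<Rightarrow> ('f, 'p) clause set \<Rightarrow> (('f, 'p) atom \<times> ('f, 'p) atom) set" where
  "depends_on L P =
     {(B, A). \<exists>c\<in>ground_instantiation L P. head c = A \<and> B \<in> lit_atom ` set (body c)}"

fun true_lit :: "(('f, 'p) atom \<Rightarrow> bool) \<Rightarrow> ('f, 'p) literal \<Rightarrow> bool" where
  "true_lit v (PosLit A) \<longleftrightarrow> v A"
| "true_lit v (NegLit A) \<longleftrightarrow> \<not> v A"

definition true_atom ::
  "('f, 'p) lang \<Rightarrow> ('f, 'p) clause set \<Rightarrow> ('f, 'p) atom set \<Rightarrow> ('f, 'p) atom set \<Rightarrow>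
   ('f, 'p) atom \<Rightarrow> bool" where
  "true_atom L P Ab I =
     wfrec (depends_on L P)
       (\<lambda>v A. if A \<in> Ab then A \<in> I
              else \<exists>c\<in>ground_instantiation L P. head c = A \<and> (\<forall>l\<in>set (body c). true_lit v l))"

lemma true_atom_unfold:
  assumes "level_mapping L P Ab lev"
  shows "true_atom L P Ab I A \<longleftrightarrow>
    (if A \<in> Ab then A \<in> I
     else \<exists>c\<in>ground_instantiation L P. head c = A \<and>
            (\<forall>l\<in>set (body c). true_lit (true_atom L P Ab I) l))"
proof -
  have "depends_on L P \<subseteq> measure lev"
    using assms by (auto simp: depends_on_def level_mapping_def)
  then have wf: "wf (depends_on L P)"
    by (rule wf_subset[OF wf_measure])
  have cut: "true_lit (cut (true_atom L P Ab I) (depends_on L P) A) l \<longleftrightarrow>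
      true_lit (true_atom L P Ab I) l"
    if "c \<in> ground_instantiation L P" "head c = A" "l \<in> set (body c)" for c l
  proof -
    have "(lit_atom l, A) \<in> depends_on L P"
      using that by (auto simp: depends_on_def)
    then show ?thesis by (cases l) (simp_all add: cut_apply)
  qed
  show ?thesis
    by (subst def_wfrec[OF true_atom_def[THEN eq_reflection] wf]) (use cut in auto)
qed

lemma true_atom_level_0:
  assumes "level_mapping L P Ab lev" "A \<in> herbrand_base L" "lev A = 0"
  shows "true_atom L P Ab I A \<longleftrightarrow> A \<in> I"
  using assms true_atom_unfold[OF assms(1)] by (auto simp: level_mapping_def)

lemma true_atom_level_pos:
  assumes "level_mapping L P Ab lev" "A \<in> herbrand_base L" "lev A > 0"
  shows "true_atom L P Ab I A \<longleftrightarrow>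
    (\<exists>c\<in>ground_instantiation L P. head c = A \<and>
       (\<forall>l\<in>set (body c). true_lit (true_atom L P Ab I) l))"
proof -
  have "A \<notin> Ab" using assms by (auto simp: level_mapping_def)
  then show ?thesis using true_atom_unfold[OF assms(1), of I A] by simp
qed

primrec form_rank :: "('f, 'p) form \<Rightarrow> nat" where
  "form_rank (Atm A) = 0"
| "form_rank (Neg \<phi>) = Suc (form_rank \<phi>)"
| "form_rank (Conj \<phi> \<psi>) = Suc (form_rank \<phi> + form_rank \<psi>)"
| "form_rank (Disj \<phi> \<psi>) = Suc (form_rank \<phi> + form_rank \<psi>)"
| "form_rank (Imp \<phi> \<psi>) = Suc (form_rank \<phi> + form_rank \<psi>)"
| "form_rank (Iff \<phi> \<psi>) = Suc (form_rank \<phi> + form_rank \<psi>)"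
| "form_rank (Forall x \<phi>) = Suc (form_rank \<phi>)"
| "form_rank (Exists x \<phi>) = Suc (form_rank \<phi>)"

lemma form_rank_inst [simp]: "form_rank (inst x t \<phi>) = form_rank \<phi>"
  by (induction \<phi>) auto

function true_form :: "'f trm set \<Rightarrow> (('f, 'p) atom \<Rightarrow> bool) \<Rightarrow> ('f, 'p) form \<Rightarrow> bool" where
  "true_form U v (Atm A) \<longleftrightarrow> v A"
| "true_form U v (Neg \<phi>) \<longleftrightarrow> \<not> true_form U v \<phi>"
| "true_form U v (Conj \<phi> \<psi>) \<longleftrightarrow> true_form U v \<phi> \<and> true_form U v \<psi>"
| "true_form U v (Disj \<phi> \<psi>) \<longleftrightarrow> true_form U v \<phi> \<or> true_form U v \<psi>"
| "true_form U v (Imp \<phi> \<psi>) \<longleftrightarrow> (true_form U v \<phi> \<longrightarrow> true_form U v \<psi>)"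
| "true_form U v (Iff \<phi> \<psi>) \<longleftrightarrow> (true_form U v \<phi> \<longleftrightarrow> true_form U v \<psi>)"
| "true_form U v (Forall x \<phi>) \<longleftrightarrow> (\<forall>t\<in>U. true_form U v (inst x t \<phi>))"
| "true_form U v (Exists x \<phi>) \<longleftrightarrow> (\<exists>t\<in>U. true_form U v (inst x t \<phi>))"
  by pat_completeness auto
termination
  by (relation "measure (\<lambda>(U, v, \<phi>). form_rank \<phi>)") auto

definition true_in ::
  "('f, 'p) lang \<Rightarrow> ('f, 'p) clause set \<Rightarrow> ('f, 'p) atom set \<Rightarrow> ('f, 'p) atom set \<Rightarrow>
   ('f, 'p) form \<Rightarrow> bool" where
  "true_in L P Ab I \<phi> \<longleftrightarrow> true_form (herbrand_universe L) (true_atom L P Ab I) \<phi>"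

definition Mod ::
  "('f, 'p) lang \<Rightarrow> ('f, 'p) clause set \<Rightarrow> ('f, 'p) atom set \<Rightarrow> ('f, 'p) form set \<Rightarrow>
   ('f, 'p) atom set set" where
  "Mod L P Ab X = {I. I \<subseteq> Ab \<and> (\<forall>\<phi>\<in>X. true_in L P Ab I \<phi>)}"

definition Cn ::
  "('f, 'p) lang \<Rightarrow> ('f, 'p) clause set \<Rightarrow> ('f, 'p) atom set \<Rightarrow> ('f, 'p) form set \<Rightarrow>
   ('f, 'p) form set" where
  "Cn L P Ab X = {\<alpha>. sentence L \<alpha> \<and> Mod L P Ab X \<subseteq> Mod L P Ab {\<alpha>}}"

definition kb_Mod_form ::
  "('f, 'p) lang \<Rightarrow> ('f, 'p) kb \<Rightarrow> ('f, 'p) form \<Rightarrow> ('f, 'p) atom set set" where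
  "kb_Mod_form L KB \<alpha> = Mod L (prog KB) (abd KB) {\<alpha>}"

definition kb_Mod :: "('f, 'p) lang \<Rightarrow> ('f, 'p) kb \<Rightarrow> ('f, 'p) atom set set" where
  "kb_Mod L KB = Mod L (prog KB) (abd KB) (kn KB \<union> ic KB)"

definition kb_bullet :: "('f, 'p) lang \<Rightarrow> ('f, 'p) kb \<Rightarrow> ('f, 'p) form set" where
  "kb_bullet L KB = Cn L (prog KB) (abd KB) (kn KB \<union> ic KB)"

definition accepted :: "('f, 'p) lang \<Rightarrow> ('f, 'p) kb \<Rightarrow> ('f, 'p) form \<Rightarrow> bool" where
  "accepted L KB \<alpha> \<longleftrightarrow> \<alpha> \<in> kb_bullet L KB"

definition kb_equiv :: "('f, 'p) lang \<Rightarrow> ('f, 'p) kb \<Rightarrow> ('f, 'p) kb \<Rightarrow> bool" where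
  "kb_equiv L KB1 KB2 \<longleftrightarrow>
     prog KB1 = prog KB2 \<and> abd KB1 = abd KB2 \<and> ic KB1 = ic KB2 \<and>
     Mod L (prog KB1) (abd KB1) (kn KB1) = Mod L (prog KB2) (abd KB2) (kn KB2)"

type_synonym ('f, 'p) kb_op = "('f, 'p) kb \<Rightarrow> ('f, 'p) form \<Rightarrow> ('f, 'p) kb"

definition contraction_function :: "('f, 'p) lang \<Rightarrow> ('f, 'p) kb_op \<Rightarrow> bool" where
  "contraction_function L contr \<longleftrightarrow>
     (\<forall>KB \<alpha>. horn_kb L KB \<longrightarrow> sentence L \<alpha> \<longrightarrow> horn_kb L (contr KB \<alpha>))"

text \<open>The postulates speak about the contractions of one knowledge base \<open>KB\<close>. Demanding
  \<open>kb_contr2\<close> of all knowledge bases at once would be unsatisfiable: by \<open>kb_contr1\<close> the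
  integrity constraints are kept, so a constraint that fails in some abductive
  interpretation stays accepted after being contracted.\<close>

definition kb_contr1 :: "('f, 'p) lang \<Rightarrow> ('f, 'p) kb_op \<Rightarrow> ('f, 'p) kb \<Rightarrow> bool" where
  "kb_contr1 L contr KB \<longleftrightarrow>
     (\<forall>\<alpha>. sentence L \<alpha> \<longrightarrow>
        prog (contr KB \<alpha>) = prog KB \<and> abd (contr KB \<alpha>) = abd KB \<and> ic (contr KB \<alpha>) = ic KB)"

definition kb_contr2 :: "('f, 'p) lang \<Rightarrow> ('f, 'p) kb_op \<Rightarrow> ('f, 'p) kb \<Rightarrow> bool" where
  "kb_contr2 L contr KB \<longleftrightarrow>
     (\<forall>\<alpha>. sentence L \<alpha> \<longrightarrow>
        \<not> (\<forall>I. I \<subseteq> abd KB \<longrightarrow> true_in L (prog KB) (abd KB) I \<alpha>) \<longrightarrow>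
        \<not> accepted L (contr KB \<alpha>) \<alpha>)"

definition kb_contr3 :: "('f, 'p) lang \<Rightarrow> ('f, 'p) kb_op \<Rightarrow> ('f, 'p) kb \<Rightarrow> bool" where
  "kb_contr3 L contr KB \<longleftrightarrow>
     (\<forall>\<alpha>. sentence L \<alpha> \<longrightarrow> kb_Mod L KB \<subseteq> kb_Mod L (contr KB \<alpha>))"

definition kb_contr4 :: "('f, 'p) lang \<Rightarrow> ('f, 'p) kb_op \<Rightarrow> ('f, 'p) kb \<Rightarrow> bool" where
  "kb_contr4 L contr KB \<longleftrightarrow>
     (\<forall>\<alpha>. sentence L \<alpha> \<longrightarrow> \<not> accepted L KB \<alpha> \<longrightarrow> kb_Mod L (contr KB \<alpha>) = kb_Mod L KB)"

definition kb_contr5 :: "('f, 'p) lang \<Rightarrow> ('f, 'p) kb_op \<Rightarrow> ('f, 'p) kb \<Rightarrow> bool" where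
  "kb_contr5 L contr KB \<longleftrightarrow>
     (\<forall>\<alpha>. sentence L \<alpha> \<longrightarrow> kb_Mod L (contr KB \<alpha>) \<inter> kb_Mod_form L KB \<alpha> \<subseteq> kb_Mod L KB)"

definition kb_contr6 :: "('f, 'p) lang \<Rightarrow> ('f, 'p) kb_op \<Rightarrow> ('f, 'p) kb \<Rightarrow> bool" where
  "kb_contr6 L contr KB \<longleftrightarrow>
     (\<forall>KB' \<alpha> \<beta>. horn_kb L KB' \<longrightarrow> sentence L \<alpha> \<longrightarrow> sentence L \<beta> \<longrightarrow>
        kb_equiv L KB KB' \<longrightarrow> kb_Mod_form L KB \<alpha> = kb_Mod_form L KB \<beta> \<longrightarrow>
        kb_Mod L (contr KB \<alpha>) = kb_Mod L (contr KB' \<beta>))"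

definition kb_contr7 :: "('f, 'p) lang \<Rightarrow> ('f, 'p) kb_op \<Rightarrow> ('f, 'p) kb \<Rightarrow> bool" where
  "kb_contr7 L contr KB \<longleftrightarrow>
     (\<forall>\<alpha> \<beta>. sentence L \<alpha> \<longrightarrow> sentence L \<beta> \<longrightarrow>
        kb_Mod L (contr KB (Conj \<alpha> \<beta>)) \<subseteq> kb_Mod L (contr KB \<alpha>) \<union> kb_Mod L (contr KB \<beta>))"

definition kb_contr8 :: "('f, 'p) lang \<Rightarrow> ('f, 'p) kb_op \<Rightarrow> ('f, 'p) kb \<Rightarrow> bool" where
  "kb_contr8 L contr KB \<longleftrightarrow>
     (\<forall>\<alpha> \<beta>. sentence L \<alpha> \<longrightarrow> sentence L \<beta> \<longrightarrow>
        \<not> accepted L (contr KB (Conj \<alpha> \<beta>)) \<alpha> \<longrightarrow>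
        kb_Mod L (contr KB \<alpha>) \<subseteq> kb_Mod L (contr KB (Conj \<alpha> \<beta>)))"

text \<open>\<open>C\<close> is a consequence operator on sentences, \<open>T\<close> the belief set being contracted and
  \<open>m \<alpha>\<close> the result of contracting \<open>T\<close> by \<open>\<alpha>\<close>.\<close>

type_synonym ('f, 'p) cons_op = "('f, 'p) form set \<Rightarrow> ('f, 'p) form set"

definition belief_set :: "('f, 'p) lang \<Rightarrow> ('f, 'p) cons_op \<Rightarrow> ('f, 'p) form set \<Rightarrow> bool" where
  "belief_set L C T \<longleftrightarrow> (\<forall>\<phi>\<in>T. sentence L \<phi>) \<and> T = C T"

definition expansion ::
  "('f, 'p) cons_op \<Rightarrow> ('f, 'p) form set \<Rightarrow> ('f, 'p) form \<Rightarrow> ('f, 'p) form set" where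
  "expansion C T \<alpha> = C (T \<union> {\<alpha>})"

definition agm_contr1 ::
  "('f, 'p) lang \<Rightarrow> ('f, 'p) cons_op \<Rightarrow> ('f, 'p) form set \<Rightarrow>
   (('f, 'p) form \<Rightarrow> ('f, 'p) form set) \<Rightarrow> bool" where
  "agm_contr1 L C T m \<longleftrightarrow> (\<forall>\<alpha>. sentence L \<alpha> \<longrightarrow> belief_set L C (m \<alpha>))"

definition agm_contr2 ::
  "('f, 'p) lang \<Rightarrow> ('f, 'p) cons_op \<Rightarrow> ('f, 'p) form set \<Rightarrow>
   (('f, 'p) form \<Rightarrow> ('f, 'p) form set) \<Rightarrow> bool" where
  "agm_contr2 L C T m \<longleftrightarrow> (\<forall>\<alpha>. sentence L \<alpha> \<longrightarrow> m \<alpha> \<subseteq> T)"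

definition agm_contr3 ::
  "('f, 'p) lang \<Rightarrow> ('f, 'p) cons_op \<Rightarrow> ('f, 'p) form set \<Rightarrow>
   (('f, 'p) form \<Rightarrow> ('f, 'p) form set) \<Rightarrow> bool" where
  "agm_contr3 L C T m \<longleftrightarrow> (\<forall>\<alpha>. sentence L \<alpha> \<longrightarrow> \<alpha> \<notin> T \<longrightarrow> m \<alpha> = T)"

definition agm_contr4 ::
  "('f, 'p) lang \<Rightarrow> ('f, 'p) cons_op \<Rightarrow> ('f, 'p) form set \<Rightarrow>
   (('f, 'p) form \<Rightarrow> ('f, 'p) form set) \<Rightarrow> bool" where
  "agm_contr4 L C T m \<longleftrightarrow> (\<forall>\<alpha>. sentence L \<alpha> \<longrightarrow> \<alpha> \<notin> C {} \<longrightarrow> \<alpha> \<notin> m \<alpha>)"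

definition agm_contr5 ::
  "('f, 'p) lang \<Rightarrow> ('f, 'p) cons_op \<Rightarrow> ('f, 'p) form set \<Rightarrow>
   (('f, 'p) form \<Rightarrow> ('f, 'p) form set) \<Rightarrow> bool" where
  "agm_contr5 L C T m \<longleftrightarrow>
     (\<forall>\<alpha> \<beta>. sentence L \<alpha> \<longrightarrow> sentence L \<beta> \<longrightarrow> Iff \<alpha> \<beta> \<in> C {} \<longrightarrow> m \<alpha> = m \<beta>)"

definition agm_contr6 ::
  "('f, 'p) lang \<Rightarrow> ('f, 'p) cons_op \<Rightarrow> ('f, 'p) form set \<Rightarrow>
   (('f, 'p) form \<Rightarrow> ('f, 'p) form set) \<Rightarrow> bool" where
  "agm_contr6 L C T m \<longleftrightarrow> (\<forall>\<alpha>. sentence L \<alpha> \<longrightarrow> T \<subseteq> expansion C (m \<alpha>) \<alpha>)"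

definition agm_contr7 ::
  "('f, 'p) lang \<Rightarrow> ('f, 'p) cons_op \<Rightarrow> ('f, 'p) form set \<Rightarrow>
   (('f, 'p) form \<Rightarrow> ('f, 'p) form set) \<Rightarrow> bool" where
  "agm_contr7 L C T m \<longleftrightarrow>
     (\<forall>\<alpha> \<beta>. sentence L \<alpha> \<longrightarrow> sentence L \<beta> \<longrightarrow> m \<alpha> \<inter> m \<beta> \<subseteq> m (Conj \<alpha> \<beta>))"

definition agm_contr8 ::
  "('f, 'p) lang \<Rightarrow> ('f, 'p) cons_op \<Rightarrow> ('f, 'p) form set \<Rightarrow>
   (('f, 'p) form \<Rightarrow> ('f, 'p) form set) \<Rightarrow> bool" where
  "agm_contr8 L C T m \<longleftrightarrow>
     (\<forall>\<alpha> \<beta>. sentence L \<alpha> \<longrightarrow> sentence L \<beta> \<longrightarrow> \<alpha> \<notin> m (Conj \<alpha> \<beta>) \<longrightarrow> m (Conj \<alpha> \<beta>) \<subseteq> m \<alpha>)"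

end

theory Submission
  imports Defs
begin

text \<open>Contracting keeps the program and the abducibles, so all belief sets are read with one
  \<open>Mod\<close> and one \<open>Cn\<close>. Then \<open>contract \<alpha>\<close> is the theory
  of the model set \<open>kb_Mod L (contr KB \<alpha>)\<close>: a sentence belongs to it iff it
  holds throughout that set. Passing to theories reverses inclusions, so each of (-2) to (-8) is the
  dual of a model-theoretic postulate: (-2), (-3), (-4), (-5), (-6) come from
  \<open>kb_contr3\<close>, \<open>kb_contr4\<close>, \<open>kb_contr2\<close>,
  \<open>kb_contr6\<close>, \<open>kb_contr5\<close>, and (-7), (-8) from their namesakes.
  \<open>mem_kb_bullet_iff\<close> carries this translation. The converse direction, from a theory
  back to its models, is \<open>Mod_Cn\<close>; it gives the closure demanded by (-1) and computes
  the models of the expansion in (-6).\<close>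

lemma Mod_antimono: "X \<subseteq> Y \<Longrightarrow> Mod L P Ab Y \<subseteq> Mod L P Ab X"
  by (auto simp: Mod_def)

lemma Mod_Un: "Mod L P Ab (X \<union> Y) = Mod L P Ab X \<inter> Mod L P Ab Y"
  by (auto simp: Mod_def)

lemma Cn_sentence: "\<phi> \<in> Cn L P Ab X \<Longrightarrow> sentence L \<phi>"
  by (simp add: Cn_def)

text \<open>A set of sentences lies inside its own closure, so closing it neither loses nor adds
  models. Sentencehood matters because \<open>Cn\<close> collects only sentences.\<close>

lemma Mod_Cn:
  assumes "\<forall>\<phi>\<in>X. sentence L \<phi>"
  shows "Mod L P Ab (Cn L P Ab X) = Mod L P Ab X"
proof
  have "X \<subseteq> Cn L P Ab X"
    using assms by (auto simp: Cn_def Mod_def)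
  then show "Mod L P Ab (Cn L P Ab X) \<subseteq> Mod L P Ab X"
    by (rule Mod_antimono)
  show "Mod L P Ab X \<subseteq> Mod L P Ab (Cn L P Ab X)"
    by (auto simp: Cn_def Mod_def)
qed

lemma belief_set_Cn:
  assumes "\<forall>\<phi>\<in>X. sentence L \<phi>"
  shows "belief_set L (Cn L P Ab) (Cn L P Ab X)"
proof -
  have "Cn L P Ab (Cn L P Ab X) = Cn L P Ab X"
    \<comment> \<open>Only the outer \<open>Cn\<close> is unfolded; the inner closure must stay
      intact for \<open>Mod_Cn\<close> to rewrite its models.\<close>
    unfolding Cn_def[of L P Ab "Cn L P Ab X"] Mod_Cn[OF assms] by (simp add: Cn_def)
  then show ?thesis
    by (simp add: belief_set_def Cn_sentence)
qed

text \<open>Every abductive interpretation is a model of the empty set. This matches the theorems of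
  \<open>Cn\<close> with the validity condition in \<open>kb_contr2\<close>.\<close>

lemma mem_Cn_empty_iff:
  "\<phi> \<in> Cn L P Ab {} \<longleftrightarrow> sentence L \<phi> \<and> (\<forall>I. I \<subseteq> Ab \<longrightarrow> true_in L P Ab I \<phi>)"
  by (auto simp: Cn_def Mod_def)

lemma Iff_mem_Cn_empty_imp_Mod_eq:
  "Iff \<phi> \<psi> \<in> Cn L P Ab {} \<Longrightarrow> Mod L P Ab {\<phi>} = Mod L P Ab {\<psi>}"
  by (auto simp: mem_Cn_empty_iff Mod_def true_in_def)

lemma mem_kb_bullet_iff:
  "\<phi> \<in> kb_bullet L KB \<longleftrightarrow> sentence L \<phi> \<and> kb_Mod L KB \<subseteq> kb_Mod_form L KB \<phi>"
  by (simp add: kb_bullet_def Cn_def kb_Mod_def kb_Mod_form_def)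

lemma sentence_Conj [simp]: "sentence L (Conj \<phi> \<psi>) \<longleftrightarrow> sentence L \<phi> \<and> sentence L \<psi>"
  by (auto simp: sentence_def)

theorem theorem8:
  fixes L :: "('f, 'p) lang"
    and KB :: "('f, 'p) kb"
    and contr :: "('f, 'p) kb \<Rightarrow> ('f, 'p) form \<Rightarrow> ('f, 'p) kb"
    and contract :: "('f, 'p) form \<Rightarrow> ('f, 'p) form set"
  assumes "horn_kb L KB"
    and "ic KB = {}"
    and "contraction_function L contr"
    and "kb_contr1 L contr KB"
    and "kb_contr2 L contr KB"
    and "kb_contr3 L contr KB"
    and "kb_contr4 L contr KB"
    and "kb_contr5 L contr KB"
    and "kb_contr6 L contr KB"
    and "kb_contr7 L contr KB"
    and "kb_contr8 L contr KB"
    and "\<And>\<alpha>. sentence L \<alpha> \<Longrightarrow> contract \<alpha> = kb_bullet L (contr KB \<alpha>)"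
  shows "agm_contr1 L (Cn L (prog KB) (abd KB)) (kb_bullet L KB) contract \<and>
         agm_contr2 L (Cn L (prog KB) (abd KB)) (kb_bullet L KB) contract \<and>
         agm_contr3 L (Cn L (prog KB) (abd KB)) (kb_bullet L KB) contract \<and>
         agm_contr4 L (Cn L (prog KB) (abd KB)) (kb_bullet L KB) contract \<and>
         agm_contr5 L (Cn L (prog KB) (abd KB)) (kb_bullet L KB) contract \<and>
         agm_contr6 L (Cn L (prog KB) (abd KB)) (kb_bullet L KB) contract \<and>
         agm_contr7 L (Cn L (prog KB) (abd KB)) (kb_bullet L KB) contract \<and>
         agm_contr8 L (Cn L (prog KB) (abd KB)) (kb_bullet L KB) contract"
proof -
  let ?C = "Cn L (prog KB) (abd KB)"
  have same: "prog (contr KB \<alpha>) = prog KB" "abd (contr KB \<alpha>) = abd KB"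
    if "sentence L \<alpha>" for \<alpha>
    using assms(4) that by (auto simp: kb_contr1_def)
  \<comment> \<open>The contracted base is again a Horn knowledge base, which supplies the
    sentencehood that \<open>Mod_Cn\<close> asks for.\<close>
  have sent: "\<forall>\<phi>\<in>kn (contr KB \<alpha>) \<union> ic (contr KB \<alpha>). sentence L \<phi>"
    if "sentence L \<alpha>" for \<alpha>
  proof -
    have "horn_kb L (contr KB \<alpha>)"
      using assms(1,3) that by (simp add: contraction_function_def)
    then show ?thesis
      by (auto simp: horn_kb_def)
  qed
  have contract_Cn: "contract \<alpha> = ?C (kn (contr KB \<alpha>) \<union> ic (contr KB \<alpha>))"
    if "sentence L \<alpha>" for \<alpha>
    using assms(12) that by (simp add: kb_bullet_def same)
  \<comment> \<open>The models of \<open>\<phi>\<close> may be taken with respect to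
    \<open>KB\<close>, since they depend only on the program and the abducibles.\<close>
  have mem: "\<phi> \<in> contract \<alpha> \<longleftrightarrow>
      sentence L \<phi> \<and> kb_Mod L (contr KB \<alpha>) \<subseteq> kb_Mod_form L KB \<phi>"
    if "sentence L \<alpha>" for \<alpha> \<phi>
    using assms(12) that by (simp add: mem_kb_bullet_iff kb_Mod_form_def same)
  have Mod_contract: "Mod L (prog KB) (abd KB) (contract \<alpha>) = kb_Mod L (contr KB \<alpha>)"
    if "sentence L \<alpha>" for \<alpha>
    using that by (simp add: contract_Cn Mod_Cn[OF sent] kb_Mod_def same)
  have "agm_contr1 L ?C (kb_bullet L KB) contract"
    by (simp add: agm_contr1_def contract_Cn belief_set_Cn[OF sent])
  moreover have "agm_contr2 L ?C (kb_bullet L KB) contract"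
    using assms(6) unfolding agm_contr2_def kb_contr3_def
    by (meson mem mem_kb_bullet_iff subset_iff)
  \<comment> \<open>Extensionality is restricted to equations about \<open>contract\<close>, so the
    equality of model sets in \<open>kb_contr4\<close> survives as a rewrite rule.\<close>
  moreover have "agm_contr3 L ?C (kb_bullet L KB) contract"
    using assms(7)
    by (simp add: agm_contr3_def kb_contr4_def accepted_def set_eq_iff[of "contract _"]
        mem mem_kb_bullet_iff)
  moreover have "agm_contr4 L ?C (kb_bullet L KB) contract"
    using assms(5,12) by (simp add: agm_contr4_def kb_contr2_def accepted_def mem_Cn_empty_iff)
  moreover have "agm_contr5 L ?C (kb_bullet L KB) contract"
    unfolding agm_contr5_def
  proof (intro allI impI)
    fix \<alpha> \<beta>
    assume \<alpha>\<beta>: "sentence L \<alpha>" "sentence L \<beta>" and "Iff \<alpha> \<beta> \<in> ?C {}"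
    then have "kb_Mod_form L KB \<alpha> = kb_Mod_form L KB \<beta>"
      unfolding kb_Mod_form_def by (intro Iff_mem_Cn_empty_imp_Mod_eq)
    \<comment> \<open>\<open>kb_contr6\<close> is applied with both knowledge bases equal to
      \<open>KB\<close>; only the sentence varies.\<close>
    moreover have "kb_equiv L KB KB"
      by (simp add: kb_equiv_def)
    ultimately have "kb_Mod L (contr KB \<alpha>) = kb_Mod L (contr KB \<beta>)"
      using assms(1,9) \<alpha>\<beta> unfolding kb_contr6_def by blast
    with \<alpha>\<beta> show "contract \<alpha> = contract \<beta>"
      by (simp add: set_eq_iff[of "contract \<alpha>"] mem)
  qed
  moreover have "agm_contr6 L ?C (kb_bullet L KB) contract"
    unfolding agm_contr6_def
  proof (intro allI impI subsetI)
    fix \<alpha> \<phi>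
    assume \<alpha>: "sentence L \<alpha>" and \<phi>: "\<phi> \<in> kb_bullet L KB"
    \<comment> \<open>Expanding by \<open>\<alpha>\<close> intersects the models of the contraction
      with those of \<open>\<alpha>\<close>, which is the set bounded by
      \<open>kb_contr5\<close>.\<close>
    have "Mod L (prog KB) (abd KB) (contract \<alpha> \<union> {\<alpha>}) =
        kb_Mod L (contr KB \<alpha>) \<inter> kb_Mod_form L KB \<alpha>"
      using \<alpha> by (simp only: Mod_Un Mod_contract kb_Mod_form_def)
    also have "\<dots> \<subseteq> kb_Mod L KB"
      using assms(8) \<alpha> by (simp add: kb_contr5_def)
    also have "\<dots> \<subseteq> kb_Mod_form L KB \<phi>"
      using \<phi> by (simp add: mem_kb_bullet_iff)
    finally show "\<phi> \<in> expansion ?C (contract \<alpha>) \<alpha>"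
      using \<phi> by (simp add: expansion_def Cn_def kb_Mod_form_def mem_kb_bullet_iff)
  qed
  moreover have "agm_contr7 L ?C (kb_bullet L KB) contract"
    unfolding agm_contr7_def
  proof (intro allI impI)
    fix \<alpha> \<beta>
    assume \<alpha>\<beta>: "sentence L \<alpha>" "sentence L \<beta>"
    \<comment> \<open>A sentence in both theories holds on the union of the two model sets, hence on
      any subset of it.\<close>
    then have "kb_Mod L (contr KB (Conj \<alpha> \<beta>)) \<subseteq>
        kb_Mod L (contr KB \<alpha>) \<union> kb_Mod L (contr KB \<beta>)"
      using assms(10) by (simp add: kb_contr7_def)
    with \<alpha>\<beta> show "contract \<alpha> \<inter> contract \<beta> \<subseteq> contract (Conj \<alpha> \<beta>)"
      by (intro subsetI) (simp add: mem, blast)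
  qed
  moreover have "agm_contr8 L ?C (kb_bullet L KB) contract"
    unfolding agm_contr8_def
  proof (intro allI impI)
    fix \<alpha> \<beta>
    assume \<alpha>\<beta>: "sentence L \<alpha>" "sentence L \<beta>" and "\<alpha> \<notin> contract (Conj \<alpha> \<beta>)"
    then have "kb_Mod L (contr KB \<alpha>) \<subseteq> kb_Mod L (contr KB (Conj \<alpha> \<beta>))"
      using assms(11,12) by (simp add: kb_contr8_def accepted_def)
    with \<alpha>\<beta> show "contract (Conj \<alpha> \<beta>) \<subseteq> contract \<alpha>"
      by (intro subsetI) (simp add: mem, blast)
  qed
  ultimately show ?thesis
    by blast
qed

end
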